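(* Let $K\in\mathbb{N}$, $\lambda,\mu>0$, and define functions $g_{K-1},\dots,g_0$ of $\theta\in\mathbb{R}$ by $g_{K-1}(\theta)=\frac{\theta}{K\mu}$ and $$g_{i-1}(\theta)=\frac{\theta-\lambda\, m(g_i(\theta))}{i\mu},\qquad i=K-1,K-2,\dots,1.$$ Then: (a) The fixed point equation $\theta=\lambda\, m(g_0(\theta))$ has a unique solution $\theta^*$. (b) Define sequences $(\underline\theta_k)_{k\ge0}$, $(\bar\theta_k)_{k\ge0}$ by $\underline\theta_0=0$, $\bar\theta_0=\lambda\, m(g_0(0))$ and, for $k\ge0$, with $\tilde\theta_k=\frac{\underline\theta_k+\bar\theta_k}{2}$, $$\underline\theta_{k+1}=\max\big\{\underline\theta_k,\min\{\tilde\theta_k,\lambda m(g_0(\tilde\theta_k))\}\big\},\qquad \bar\theta_{k+1}=\min\big\{\bar\theta_k,\max\{\tilde\theta_k,\lambda m(g_0(\tilde\theta_k))\}\big\}.$$ Then $\underline\theta_k\uparrow\theta^*$ and $\bar\theta_k\downarrow\theta^*$ as $k\to\infty$ (monotone convergence, in the non-strict sense).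
   Context: $V$ is a positive random variable with continuous distribution function $G$ and finite mean, $\overline{G}(u)=P(V\ge u)$ for $u\in\mathbb{R}$, and for $B\in\mathbb{R}$, $m(B)=\max_{u}(u-B)\overline{G}(u)$. *)

theory Defs
  imports "HOL-Probability.Probability"
begin

definition tail_prob :: "'a measure \<Rightarrow> ('a \<Rightarrow> real) \<Rightarrow> real \<Rightarrow> real" where
  "tail_prob M V u = \<P>(x in M. u \<le> V x)"

text \<open>A genuine maximum, not a supremum: \<open>Greatest\<close> denotes the largest element of the set of
  values and is unspecified if there is none.\<close>

definition max_gain :: "(real \<Rightarrow> real) \<Rightarrow> real \<Rightarrow> real" where
  "max_gain H B = (GREATEST y. \<exists>u. y = (u - B) * H u)"

text \<open>The functions \<open>g\<^sub>i\<close> for \<open>0 \<le> i \<le> K - 1\<close>. The recursion runs downwards from \<open>i = K - 1\<close>;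
  it is written here with \<open>i\<close> and \<open>i + 1\<close> in place of \<open>i - 1\<close> and \<open>i\<close>, and values at
  \<open>i \<ge> K\<close> are irrelevant. The lemmas below give the equations in their usual indexing.\<close>

function g_fun :: "(real \<Rightarrow> real) \<Rightarrow> nat \<Rightarrow> real \<Rightarrow> real \<Rightarrow> nat \<Rightarrow> real \<Rightarrow> real" where
  "g_fun m K l \<mu> i \<theta> =
     (if K \<le> Suc i then \<theta> / (real K * \<mu>)
      else (\<theta> - l * m (g_fun m K l \<mu> (Suc i) \<theta>)) / (real (Suc i) * \<mu>))"
  by pat_completeness auto
termination
  by (relation "Wellfounded.measure (\<lambda>(m, K, l, \<mu>, i, \<theta>). K - i)") auto

declare g_fun.simps [simp del]

lemma g_fun_top:
  "g_fun m K l \<mu> (K - 1) \<theta> = \<theta> / (real K * \<mu>)"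
  by (cases K; subst g_fun.simps) simp_all

lemma g_fun_step:
  assumes "1 \<le> i" and "i \<le> K - 1"
  shows "g_fun m K l \<mu> (i - 1) \<theta> = (\<theta> - l * m (g_fun m K l \<mu> i \<theta>)) / (real i * \<mu>)"
  using assms by (subst g_fun.simps) auto

text \<open>The two interlaced sequences, for a general map \<open>F\<close> whose fixed point is sought.\<close>

fun lower_seq :: "(real \<Rightarrow> real) \<Rightarrow> nat \<Rightarrow> real"
  and upper_seq :: "(real \<Rightarrow> real) \<Rightarrow> nat \<Rightarrow> real" where
  "lower_seq F 0 = 0"
| "upper_seq F 0 = F 0"
| "lower_seq F (Suc k) =
     (let t = (lower_seq F k + upper_seq F k) / 2 in max (lower_seq F k) (min t (F t)))"
| "upper_seq F (Suc k) =
     (let t = (lower_seq F k + upper_seq F k) / 2 in min (upper_seq F k) (max t (F t)))"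

end

theory Submission
  imports Defs
begin

text \<open>The gain \<open>m\<close> is a maximum of the maps \<open>B \<mapsto> (u - B) H u\<close>, each antitone and
  1-Lipschitz on \<open>u \<ge> B\<close>; hence \<open>m\<close> is antitone and 1-Lipschitz. Each \<open>g\<^sub>i\<close> is then continuous and
  increasing, and \<open>F\<close> is continuous, antitone and nonnegative. For such an \<open>F\<close> the fixed point
  exists by the intermediate value theorem and is unique by monotonicity. Moreover \<open>t\<close> and \<open>F t\<close>
  lie on opposite sides of the fixed point, so the interlaced sequences always enclose it while
  their distance is at least halved in each step.\<close>

text \<open>Collects what the analysis of the gain uses about the tail probability.
  \<open>vanishing\<close> is the form in which the finite mean enters: large thresholds earn
  nothing in the limit, so a maximum exists.\<close>

locale vanishing_gain =
  fixes H :: "real \<Rightarrow> real"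
  assumes continuous: "continuous_on UNIV H"
    and nonneg: "0 \<le> H u"
    and le_one: "H u \<le> 1"
    and vanishing: "((\<lambda>u. (u - B) * H u) \<longlongrightarrow> 0) at_top"
begin

text \<open>If no gain is positive, \<open>u = B\<close> with gain 0 is optimal. Otherwise gains
  left of \<open>B\<close> are nonpositive and gains far to the right drop below a fixed positive
  one, so only a compact interval competes.\<close>

lemma gain_has_maximum: "\<exists>u\<ge>B. \<forall>v. (v - B) * H v \<le> (u - B) * H u"
proof (cases "\<exists>w. 0 < (w - B) * H w")
  case False
  then show ?thesis by (intro exI[of _ B]) (auto simp: not_less)
next
  case True
  then obtain w where w: "0 < (w - B) * H w" by blast
  have wB: "B < w"
    using w nonneg[of w] by (simp add: zero_less_mult_iff)
  have "eventually (\<lambda>u. (u - B) * H u < (w - B) * H w) at_top"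
    using order_tendstoD(2)[OF vanishing w] .
  then obtain N where N: "\<And>u. N \<le> u \<Longrightarrow> (u - B) * H u < (w - B) * H w"
    unfolding eventually_at_top_linorder by blast
  \<comment> \<open>The right end \<open>max N w\<close> keeps \<open>w\<close> inside the interval,
    so the maximum over it is at least the positive gain at \<open>w\<close>.\<close>
  have "continuous_on {B..max N w} (\<lambda>u. (u - B) * H u)"
    by (intro continuous_intros continuous_on_subset[OF continuous]) auto
  then obtain u where u: "u \<in> {B..max N w}"
      "\<And>v. v \<in> {B..max N w} \<Longrightarrow> (v - B) * H v \<le> (u - B) * H u"
    using continuous_attains_sup[of "{B..max N w}" "\<lambda>u. (u - B) * H u"] wB by fastforce
  have uw: "(w - B) * H w \<le> (u - B) * H u"
    using u(2)[of w] wB by auto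
  have "(v - B) * H v \<le> (u - B) * H u" for v
  proof -
    consider "v < B" | "v \<in> {B..max N w}" | "N \<le> v" by fastforce
    then show ?thesis
    proof cases
      case 1
      then have "(v - B) * H v \<le> 0"
        using nonneg[of v] by (intro mult_nonpos_nonneg) auto
      then show ?thesis using w uw by linarith
    next
      case 2
      then show ?thesis by (rule u(2))
    next
      case 3
      then show ?thesis using N[of v] uw by linarith
    qed
  qed
  then show ?thesis using u(1) by auto
qed

lemma max_gain_attained:
  obtains u where "B \<le> u" "max_gain H B = (u - B) * H u"
proof -
  obtain u where u: "B \<le> u" "\<And>v. (v - B) * H v \<le> (u - B) * H u"
    using gain_has_maximum by blast
  have "max_gain H B = (u - B) * H u"
    unfolding max_gain_def using u(2) by (intro Greatest_equality) auto
  with u(1) show thesis by (rule that)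
qed

lemma max_gain_upper: "(v - B) * H v \<le> max_gain H B"
proof -
  obtain u where u: "\<And>v. (v - B) * H v \<le> (u - B) * H u"
    using gain_has_maximum by blast
  then have "max_gain H B = (u - B) * H u"
    unfolding max_gain_def by (intro Greatest_equality) auto
  then show ?thesis using u by simp
qed

lemma max_gain_nonneg: "0 \<le> max_gain H B"
  using max_gain_upper[of B B] by simp

lemma max_gain_antimono:
  assumes "B \<le> C"
  shows "max_gain H C \<le> max_gain H B"
proof -
  obtain u where u: "max_gain H C = (u - C) * H u"
    using max_gain_attained .
  also have "\<dots> \<le> (u - B) * H u"
    using assms nonneg by (intro mult_right_mono) auto
  also have "\<dots> \<le> max_gain H B" by (rule max_gain_upper)
  finally show ?thesis .
qed

text \<open>At the maximiser \<open>u\<close> for \<open>B\<close>, raising \<open>B\<close> to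
  \<open>C\<close> costs \<open>(C - B) * H u\<close>, which is at most \<open>C - B\<close> because
  \<open>H\<close> is bounded by 1.\<close>

lemma max_gain_diff_le:
  assumes "B \<le> C"
  shows "max_gain H B \<le> max_gain H C + (C - B)"
proof -
  obtain u where u: "max_gain H B = (u - B) * H u"
    using max_gain_attained .
  also have "\<dots> = (u - C) * H u + (C - B) * H u"
    by (simp add: algebra_simps)
  also have "\<dots> \<le> max_gain H C + (C - B)"
    using assms le_one by (intro add_mono max_gain_upper mult_left_le) auto
  finally show ?thesis .
qed

lemma continuous_max_gain: "continuous_on UNIV (max_gain H)"
proof -
  have "dist (max_gain H B) (max_gain H C) \<le> 1 * dist B C" for B C
    using max_gain_antimono[of B C] max_gain_antimono[of C B]
      max_gain_diff_le[of B C] max_gain_diff_le[of C B]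
    by (cases "B \<le> C") (auto simp: dist_real_def)
  then have "1-lipschitz_on UNIV (max_gain H)"
    by (intro lipschitz_onI) auto
  then show ?thesis by (rule lipschitz_on_continuous_on)
qed

end

text \<open>A continuous distribution function has no atoms, so the tail is its complement to 1 and
  is continuous. The limit follows by dominated convergence, with the integrable bound supplied by
  the finite mean.\<close>

lemma (in prob_space) vanishing_gain_tail_prob:
  assumes [measurable]: "V \<in> borel_measurable M"
    and cont: "continuous_on UNIV (cdf (distr M borel V))"
    and int: "integrable M V"
  shows "vanishing_gain (tail_prob M V)"
proof
  interpret D: real_distribution "distr M borel V"
    by (simp add: real_distribution_distr)
  have "tail_prob M V u = 1 - cdf (distr M borel V) u" for u
  proof -
    have "isCont (cdf (distr M borel V)) u"
      using cont by (simp add: continuous_on_eq_continuous_at)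
    then have atom: "measure (distr M borel V) {u} = 0"
      using D.isCont_cdf by blast
    have "tail_prob M V u = measure (distr M borel V) {u..}"
      by (simp add: tail_prob_def measure_distr vimage_def Int_def conj_commute)
    \<comment> \<open>The point \<open>u\<close> belongs to both the tail and the set measured by
      the distribution function; it has mass 0.\<close>
    also have "{u..} = UNIV - ({..u} - {u})" by auto
    also have "measure (distr M borel V) \<dots> = 1 - measure (distr M borel V) ({..u} - {u})"
      using D.prob_compl[of "{..u} - {u}"] by simp
    also have "measure (distr M borel V) ({..u} - {u}) = cdf (distr M borel V) u"
      using atom by (subst D.finite_measure_Diff) (auto simp: cdf_def)
    finally show ?thesis .
  qed
  then have "tail_prob M V = (\<lambda>u. 1 - cdf (distr M borel V) u)" by auto
  then show "continuous_on UNIV (tail_prob M V)"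
    using cont by (auto intro!: continuous_intros)
next
  fix u show "0 \<le> tail_prob M V u" "tail_prob M V u \<le> 1"
    by (auto simp: tail_prob_def)
next
  fix B
  let ?s = "\<lambda>u x. (u - B) * indicator {x \<in> space M. u \<le> V x} x :: real"
  have "((\<lambda>u. \<integral>x. ?s u x \<partial>M) \<longlongrightarrow> (\<integral>x. 0 \<partial>M)) at_top"
  proof (rule integral_dominated_convergence_at_top)
    show "integrable M (\<lambda>x. \<bar>V x\<bar> + \<bar>B\<bar>)"
      using int by auto
    \<comment> \<open>On the event \<open>u \<le> V x\<close> with \<open>u \<ge> B\<close>, one has
      \<open>0 \<le> u - B \<le> V x - B\<close>.\<close>
    show "eventually (\<lambda>u. AE x in M. norm (?s u x) \<le> \<bar>V x\<bar> + \<bar>B\<bar>) at_top"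
      using eventually_ge_at_top[of B]
      by eventually_elim (auto simp: indicator_def)
    show "AE x in M. ((\<lambda>u. ?s u x) \<longlongrightarrow> 0) at_top"
    proof (intro AE_I2 tendsto_eventually)
      fix x
      show "eventually (\<lambda>u. ?s u x = 0) at_top"
        using eventually_gt_at_top[of "V x"] by eventually_elim simp
    qed
  qed auto
  moreover have "(\<integral>x. ?s u x \<partial>M) = (u - B) * tail_prob M V u" for u
    by (simp add: tail_prob_def)
  ultimately show "((\<lambda>u. (u - B) * tail_prob M V u) \<longlongrightarrow> 0) at_top"
    by (simp only: integral_zero)
qed

text \<open>Induction downwards in \<open>i\<close>: composing the antitone \<open>m\<close> with an
  increasing function and subtracting the result from \<theta> gives an increasing function
  again.\<close>

lemma g_fun_mono_continuous:
  assumes m: "continuous_on UNIV m" "antimono m" and "0 < l" "0 < \<mu>"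
  shows "mono (g_fun m K l \<mu> i) \<and> continuous_on UNIV (g_fun m K l \<mu> i)"
proof (induction "K - i" arbitrary: i rule: less_induct)
  case less
  show ?case
  proof (cases "K \<le> Suc i")
    case True
    \<comment> \<open>The product form treats \<open>K = 0\<close> uniformly: there the inverse is 0
      by convention and the function is constant.\<close>
    then have "g_fun m K l \<mu> i = (\<lambda>\<theta>. \<theta> * inverse (real K * \<mu>))"
      by (intro ext) (subst g_fun.simps, simp add: divide_inverse)
    then show ?thesis
      using \<open>0 < \<mu>\<close> by (auto intro!: monoI mult_right_mono continuous_intros)
  next
    case False
    let ?g = "g_fun m K l \<mu> (Suc i)"
    have IH: "mono ?g" "continuous_on UNIV ?g"
      using less[of "Suc i"] False by auto
    have eq: "g_fun m K l \<mu> i = (\<lambda>\<theta>. (\<theta> - l * m (?g \<theta>)) / (real (Suc i) * \<mu>))"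
      using False by (intro ext) (subst g_fun.simps, simp)
    have "mono (\<lambda>\<theta>. (\<theta> - l * m (?g \<theta>)) / (real (Suc i) * \<mu>))"
      using assms by (intro monoI divide_right_mono diff_mono mult_left_mono
          antimonoD[OF m(2)] monoD[OF IH(1)]) auto
    moreover have "continuous_on UNIV (\<lambda>\<theta>. (\<theta> - l * m (?g \<theta>)) / (real (Suc i) * \<mu>))"
      using \<open>0 < \<mu>\<close>
      by (intro continuous_intros IH continuous_on_compose2[OF m(1) IH(2)]) auto
    ultimately show ?thesis unfolding eq ..
  qed
qed

lemma antimono_unique_fixed_point:
  fixes F :: "real \<Rightarrow> real"
  assumes "continuous_on UNIV F" "antimono F" "\<And>x. 0 \<le> F x"
  shows "\<exists>!x. x = F x"
proof -
  \<comment> \<open>On \<open>[0, F 0]\<close> the difference \<open>x - F x\<close> goes from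
    \<open>- F 0 \<le> 0\<close> to \<open>F 0 - F (F 0)\<close>, which is nonnegative since
    \<open>F\<close> is antitone.\<close>
  have "\<exists>x\<ge>0. x \<le> F 0 \<and> x - F x = 0"
    using assms antimonoD[OF assms(2), of 0 "F 0"]
    by (intro IVT') (auto intro!: continuous_intros intro: continuous_on_subset)
  then obtain x where x: "x = F x" by auto
  moreover have "y = x" if "y = F y" for y
    using x that antimonoD[OF assms(2), of x y] antimonoD[OF assms(2), of y x] by linarith
  ultimately show ?thesis by blast
qed

lemma incseq_lower_seq: "incseq (lower_seq F)"
  by (rule incseq_SucI) (simp add: Let_def)

lemma decseq_upper_seq: "decseq (upper_seq F)"
  by (rule decseq_SucI) (simp add: Let_def)

lemma seq_enclose_fixed_point:
  assumes "antimono F" "\<And>x. 0 \<le> F x" and fp: "x = F x"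
  shows "lower_seq F k \<le> x \<and> x \<le> upper_seq F k \<and> upper_seq F k - lower_seq F k \<le> F 0 / 2 ^ k"
proof (induction k)
  case 0
  \<comment> \<open>From \<open>0 \<le> x\<close> antitonicity gives
    \<open>x = F x \<le> F 0\<close>, the initial upper bound.\<close>
  have "0 \<le> x" using assms(2)[of x] fp by simp
  then show ?case using fp antimonoD[OF assms(1), of 0 x] by auto
next
  case (Suc k)
  define t where "t = (lower_seq F k + upper_seq F k) / 2"
  have lower: "lower_seq F (Suc k) = max (lower_seq F k) (min t (F t))"
    and upper: "upper_seq F (Suc k) = min (upper_seq F k) (max t (F t))"
    by (simp_all add: t_def Let_def)
  have mid: "t - lower_seq F k = (upper_seq F k - lower_seq F k) / 2"
      "upper_seq F k - t = (upper_seq F k - lower_seq F k) / 2"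
    by (simp_all add: t_def field_simps)
  have half: "F 0 / 2 ^ Suc k = (F 0 / 2 ^ k) / 2" by simp
  \<comment> \<open>In the first case the lower bound moves up to the midpoint \<open>t\<close>, in
    the second the upper bound moves down to it. The other bound can only tighten without passing
    \<open>x\<close>, so the width at least halves.\<close>
  have "t \<le> x \<and> x \<le> F t \<or> F t \<le> x \<and> x \<le> t"
    using antimonoD[OF assms(1), of t x] antimonoD[OF assms(1), of x t] fp by linarith
  then show ?case
    using Suc.IH mid unfolding lower upper half by (auto simp: max_def min_def)
qed

text \<open>The enclosing interval contains \<open>x\<close> and has width at most
  \<open>F 0 / 2 ^ k\<close>, so both of its ends are squeezed to \<open>x\<close>.\<close>

lemma seq_tendsto_fixed_point:
  assumes "antimono F" "\<And>x. 0 \<le> F x" "x = F x"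
  shows "lower_seq F \<longlonglongrightarrow> x" and "upper_seq F \<longlonglongrightarrow> x"
proof -
  note enc = seq_enclose_fixed_point[OF assms]
  have lim: "(\<lambda>k. F 0 / 2 ^ k) \<longlonglongrightarrow> 0"
    by (rule LIMSEQ_divide_realpow_zero) simp
  have "(\<lambda>k. x - F 0 / 2 ^ k) \<longlonglongrightarrow> x" "(\<lambda>k. x + F 0 / 2 ^ k) \<longlonglongrightarrow> x"
    using tendsto_diff[OF tendsto_const lim, of x] tendsto_add[OF tendsto_const lim, of x]
    by simp_all
  moreover have "x - F 0 / 2 ^ k \<le> lower_seq F k" "lower_seq F k \<le> x"
      "x \<le> upper_seq F k" "upper_seq F k \<le> x + F 0 / 2 ^ k" for k
    using enc[of k] by linarith+
  ultimately show "lower_seq F \<longlonglongrightarrow> x" "upper_seq F \<longlonglongrightarrow> x"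
    by (auto intro: tendsto_sandwich[of "\<lambda>k. x - F 0 / 2 ^ k" _ _ "\<lambda>_. x"]
        tendsto_sandwich[of "\<lambda>_. x" _ _ "\<lambda>k. x + F 0 / 2 ^ k"])
qed

theorem theorem19:
  fixes M :: "'a measure" and V :: "'a \<Rightarrow> real" and K :: nat and l \<mu> :: real
    and m :: "real \<Rightarrow> real" and g :: "nat \<Rightarrow> real \<Rightarrow> real" and F :: "real \<Rightarrow> real"
  assumes "prob_space M"
    and "V \<in> borel_measurable M"
    and "AE x in M. 0 < V x"
    and "continuous_on UNIV (cdf (distr M borel V))"
    and "integrable M V"
    and "1 \<le> K" and "0 < l" and "0 < \<mu>"
  defines "m \<equiv> max_gain (tail_prob M V)"
  defines "g \<equiv> g_fun m K l \<mu>"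
  defines "F \<equiv> (\<lambda>\<theta>. l * m (g 0 \<theta>))"
  shows "(\<exists>!\<theta>. \<theta> = F \<theta>) \<and>
    (\<forall>\<theta>s. \<theta>s = F \<theta>s \<longrightarrow>
       incseq (lower_seq F) \<and> lower_seq F \<longlonglongrightarrow> \<theta>s \<and>
       decseq (upper_seq F) \<and> upper_seq F \<longlonglongrightarrow> \<theta>s)"
proof -
  interpret prob_space M by fact
  interpret vanishing_gain "tail_prob M V"
    using assms(2,4,5) by (rule vanishing_gain_tail_prob)
  have m: "continuous_on UNIV m" "antimono m" "\<And>B. 0 \<le> m B"
    unfolding m_def
    by (auto intro: continuous_max_gain antimonoI max_gain_antimono max_gain_nonneg)
  have g: "mono (g 0)" "continuous_on UNIV (g 0)"
    unfolding g_def using g_fun_mono_continuous[OF m(1,2) \<open>0 < l\<close> \<open>0 < \<mu>\<close>] by auto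
  have F: "continuous_on UNIV F" "antimono F" "\<And>x. 0 \<le> F x"
    unfolding F_def using \<open>0 < l\<close> m(3)
    by (auto intro!: continuous_intros continuous_on_compose2[OF m(1) g(2)] antimonoI
        antimonoD[OF m(2)] monoD[OF g(1)])
  show ?thesis
    using antimono_unique_fixed_point[OF F] seq_tendsto_fixed_point[OF F(2,3)]
      incseq_lower_seq decseq_upper_seq by blast
qed

end
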